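(* Let $\mathbb{E}: K\xrightarrow{k}X\xrightarrow{f}M$ be a Schreier extension of monoids with $K$ commutative and cancellative. Let $R_{\mathbb{E}}=\{(x,z)\in X\times X: z=k(a)+x\text{ for some }a\in K\}$, with $r_1(x,z)=x$, $r_2(x,z)=z$, $s_0(x)=(x,x)$, and let $k_1\colon K\to R_{\mathbb{E}}$, $k_1(a)=(0,k(a))$. Then $K\xrightarrow{k_1}R_{\mathbb{E}}\xrightarrow{r_1}X$ with section $s_0\colon X\to R_{\mathbb{E}}$ is a Schreier point; consequently, the relation $\mathcal{R}_{\mathbb{E}}=(R_{\mathbb{E}},r_1,r_2,s_0)$ is an $S$-reflexive relation on $X$.
   Context: Monoids $K,X$ are written additively ($X$ is not assumed commutative) and $M$ multiplicatively with unit $1$. A monoid extension $K\xrightarrow{k}X\xrightarrow{f}M$ consists of a surjective monoid homomorphism $f$ and a kernel $(K,k)$ of $f$ (so $k$ is injective with image $\{x: f(x)=1\}$). It is a Schreier extension if for every $m\in M$ there is $u\in f^{-1}(m)$ such that for every $x\in f^{-1}(m)$ there is a unique $a\in K$ with $x=k(a)+u$. $R_{\mathbb{E}}$ is a submonoid of $X\times X$. A Schreier point is a split extension of monoids $K\xrightarrow{k}B\xrightarrow{f}M$ with a fixed homomorphism $s\colon M\to B$, $fs=id_M$, where $(K,k)$ is a kernel of $f$, for which there is a unique map of sets $q\colon B\to K$ with $b=kq(b)+sf(b)$ for all $b\in B$. A reflexive relation $(R,\rho_1,\rho_2\colon R\to X,\delta\colon X\to R)$ in the category of monoids ($\rho_1,\rho_2$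 jointly monomorphic, $\rho_1\delta=\rho_2\delta=id_X$) is an $S$-reflexive relation if $\rho_1$, split by $\delta$, together with a kernel of $\rho_1$, is a Schreier point. *)

theory Defs
  imports "HOL-Algebra.Coset" "HOL-Algebra.Divisibility"
begin

text \<open>All monoids are HOL-Algebra structures and hence written multiplicatively, including
  those written additively in the mathematical text: there, $k(a)+u$ is
  \<open>k a \<otimes>\<^bsub>X\<^esub> u\<close> and $0$ is \<open>\<one>\<close>.\<close>

text \<open>The library's \<^const>\<open>hom\<close> does not require the unit to be preserved.\<close>

definition mon_hom :: "('a, 'm) monoid_scheme \<Rightarrow> ('b, 'n) monoid_scheme \<Rightarrow> ('a \<Rightarrow> 'b) set" where
  "mon_hom A B = {h. h \<in> hom A B \<and> h \<one>\<^bsub>A\<^esub> = \<one>\<^bsub>B\<^esub>}"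

text \<open>For monoid homomorphisms, \<open>(K, k)\<close> is a kernel of \<open>f\<close> in the category of monoids iff
  \<open>k\<close> is injective with image the preimage of the unit; see \<open>is_kernel_universal\<close> below for the
  universal property.\<close>

definition is_kernel ::
  "('k, 'p) monoid_scheme \<Rightarrow> ('k \<Rightarrow> 'x) \<Rightarrow> ('x, 'q) monoid_scheme \<Rightarrow> ('x \<Rightarrow> 'm)
    \<Rightarrow> ('m, 'r) monoid_scheme \<Rightarrow> bool" where
  "is_kernel K k X f M \<longleftrightarrow>
     monoid K \<and> k \<in> mon_hom K X \<and> inj_on k (carrier K) \<and> k ` carrier K = kernel X M f"

definition monoid_extension ::
  "('k, 'p) monoid_scheme \<Rightarrow> ('k \<Rightarrow> 'x) \<Rightarrow> ('x, 'q) monoid_scheme \<Rightarrow> ('x \<Rightarrow> 'm)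
    \<Rightarrow> ('m, 'r) monoid_scheme \<Rightarrow> bool" where
  "monoid_extension K k X f M \<longleftrightarrow>
     monoid X \<and> monoid M \<and> f \<in> mon_hom X M \<and> f ` carrier X = carrier M \<and> is_kernel K k X f M"

definition schreier_extension ::
  "('k, 'p) monoid_scheme \<Rightarrow> ('k \<Rightarrow> 'x) \<Rightarrow> ('x, 'q) monoid_scheme \<Rightarrow> ('x \<Rightarrow> 'm)
    \<Rightarrow> ('m, 'r) monoid_scheme \<Rightarrow> bool" where
  "schreier_extension K k X f M \<longleftrightarrow>
     monoid_extension K k X f M \<and>
     (\<forall>m\<in>carrier M. \<exists>u\<in>carrier X. f u = m \<and>
        (\<forall>x\<in>carrier X. f x = m \<longrightarrow> (\<exists>!a. a \<in> carrier K \<and> x = k a \<otimes>\<^bsub>X\<^esub> u)))"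

text \<open>Maps of sets between carriers are taken extensionally (\<open>\<rightarrow>\<^sub>E\<close>), so that uniqueness of \<open>q\<close>
  is uniqueness on the carrier.\<close>

definition schreier_point ::
  "('k, 'p) monoid_scheme \<Rightarrow> ('k \<Rightarrow> 'b) \<Rightarrow> ('b, 'q) monoid_scheme \<Rightarrow> ('b \<Rightarrow> 'm)
    \<Rightarrow> ('m, 'r) monoid_scheme \<Rightarrow> ('m \<Rightarrow> 'b) \<Rightarrow> bool" where
  "schreier_point K k B f M s \<longleftrightarrow>
     monoid B \<and> monoid M \<and> f \<in> mon_hom B M \<and> s \<in> mon_hom M B \<and>
     (\<forall>m\<in>carrier M. f (s m) = m) \<and> is_kernel K k B f M \<and>
     (\<exists>!q. q \<in> carrier B \<rightarrow>\<^sub>E carrier K \<and> (\<forall>b\<in>carrier B. b = k (q b) \<otimes>\<^bsub>B\<^esub> s (f b)))"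

text \<open>The test objects \<open>T\<close> may be restricted to carriers in \<open>'r \<times> 'r\<close> without loss of generality:
  see \<open>jointly_monic_iff_inj_on\<close>.\<close>

definition jointly_monic :: "('r, 'p) monoid_scheme \<Rightarrow> ('r \<Rightarrow> 'x) \<Rightarrow> ('r \<Rightarrow> 'y) \<Rightarrow> bool" where
  "jointly_monic R p1 p2 \<longleftrightarrow>
     (\<forall>(T :: ('r \<times> 'r) monoid) g h. monoid T \<and> g \<in> mon_hom T R \<and> h \<in> mon_hom T R \<and>
        (\<forall>t\<in>carrier T. p1 (g t) = p1 (h t)) \<and> (\<forall>t\<in>carrier T. p2 (g t) = p2 (h t))
        \<longrightarrow> (\<forall>t\<in>carrier T. g t = h t))"

definition reflexive_relation ::
  "('x, 'p) monoid_scheme \<Rightarrow> ('r, 'q) monoid_scheme \<Rightarrow> ('r \<Rightarrow> 'x) \<Rightarrow> ('r \<Rightarrow> 'x) \<Rightarrow> ('x \<Rightarrow> 'r)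
    \<Rightarrow> bool" where
  "reflexive_relation X R p1 p2 d \<longleftrightarrow>
     monoid X \<and> monoid R \<and> p1 \<in> mon_hom R X \<and> p2 \<in> mon_hom R X \<and> d \<in> mon_hom X R \<and>
     jointly_monic R p1 p2 \<and>
     (\<forall>x\<in>carrier X. p1 (d x) = x) \<and> (\<forall>x\<in>carrier X. p2 (d x) = x)"

text \<open>The choice of kernel is immaterial (\<open>S_reflexive_relation_kernel\<close>); carriers in the type of
  \<open>R\<close> suffice, since the preimage of the unit with its inclusion is a kernel.\<close>

definition S_reflexive_relation ::
  "('x, 'p) monoid_scheme \<Rightarrow> ('r, 'q) monoid_scheme \<Rightarrow> ('r \<Rightarrow> 'x) \<Rightarrow> ('r \<Rightarrow> 'x) \<Rightarrow> ('x \<Rightarrow> 'r)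
    \<Rightarrow> bool" where
  "S_reflexive_relation X R p1 p2 d \<longleftrightarrow>
     reflexive_relation X R p1 p2 d \<and>
     (\<exists>(N :: 'r monoid) n. is_kernel N n R p1 X \<and> schreier_point N n R p1 X d)"

text \<open>$R_{\mathbb{E}}$, with the operations of the direct product \<open>X \<times>\<times> X\<close>.\<close>

definition R\<^sub>E ::
  "('k, 'p) monoid_scheme \<Rightarrow> ('k \<Rightarrow> 'x) \<Rightarrow> ('x, 'q) monoid_scheme \<Rightarrow> ('x \<times> 'x) monoid" where
  "R\<^sub>E K k X = (X \<times>\<times> X)
     \<lparr>carrier := {(x, z). x \<in> carrier X \<and> z \<in> carrier X \<and>
                         (\<exists>a\<in>carrier K. z = k a \<otimes>\<^bsub>X\<^esub> x)}\<rparr>"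

lemma mon_homD:
  assumes "h \<in> mon_hom A B"
  shows "x \<in> carrier A \<Longrightarrow> h x \<in> carrier B"
    and "x \<in> carrier A \<Longrightarrow> y \<in> carrier A \<Longrightarrow> h (x \<otimes>\<^bsub>A\<^esub> y) = h x \<otimes>\<^bsub>B\<^esub> h y"
    and "h \<one>\<^bsub>A\<^esub> = \<one>\<^bsub>B\<^esub>"
  using assms by (auto simp: mon_hom_def hom_def)

lemma is_kernel_lift:
  assumes ker: "is_kernel K k X f M" and T: "monoid T" and g: "g \<in> mon_hom T X"
    and triv: "\<forall>t\<in>carrier T. f (g t) = \<one>\<^bsub>M\<^esub>"
  defines "g' \<equiv> \<lambda>t. inv_into (carrier K) k (g t)"
  shows "g' \<in> mon_hom T K" "\<forall>t\<in>carrier T. k (g' t) = g t"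
proof -
  from ker have K: "monoid K" and k: "k \<in> mon_hom K X" and inj: "inj_on k (carrier K)"
    and im: "k ` carrier K = kernel X M f" by (auto simp: is_kernel_def)
  interpret K: monoid K by fact
  interpret T: monoid T by fact
  have "g t \<in> k ` carrier K" if "t \<in> carrier T" for t
    using that triv mon_homD(1)[OF g] by (auto simp: im kernel_def)
  then have g': "g' t \<in> carrier K" "k (g' t) = g t" if "t \<in> carrier T" for t
    using that unfolding g'_def by (auto intro: inv_into_into f_inv_into_f)
  then show "\<forall>t\<in>carrier T. k (g' t) = g t" by blast
  have "g' (x \<otimes>\<^bsub>T\<^esub> y) = g' x \<otimes>\<^bsub>K\<^esub> g' y" if "x \<in> carrier T" "y \<in> carrier T" for x y
    by (rule inj_onD[OF inj]) (use that g' mon_homD[OF g] mon_homD[OF k] in auto)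
  moreover have "g' \<one>\<^bsub>T\<^esub> = \<one>\<^bsub>K\<^esub>"
    by (rule inj_onD[OF inj]) (use g' mon_homD[OF g] mon_homD[OF k] in auto)
  ultimately show "g' \<in> mon_hom T K" using g' by (auto simp: mon_hom_def hom_def)
qed

lemma is_kernel_universal:
  assumes ker: "is_kernel K k X f M" and T: "monoid T" and g: "g \<in> mon_hom T X"
    and triv: "\<forall>t\<in>carrier T. f (g t) = \<one>\<^bsub>M\<^esub>"
  shows "\<exists>!g'. g' \<in> mon_hom T K \<inter> extensional (carrier T) \<and> (\<forall>t\<in>carrier T. k (g' t) = g t)"
proof -
  let ?g = "\<lambda>t. inv_into (carrier K) k (g t)"
  interpret T: monoid T by fact
  note l = is_kernel_lift[OF assms]
  have inj: "inj_on k (carrier K)" using ker by (simp add: is_kernel_def)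
  show ?thesis
  proof (rule ex1I[of _ "restrict ?g (carrier T)"])
    show "restrict ?g (carrier T) \<in> mon_hom T K \<inter> extensional (carrier T) \<and>
      (\<forall>t\<in>carrier T. k (restrict ?g (carrier T) t) = g t)"
      using l by (auto simp: mon_hom_def hom_def)
    fix h assume h: "h \<in> mon_hom T K \<inter> extensional (carrier T) \<and> (\<forall>t\<in>carrier T. k (h t) = g t)"
    have "h t = ?g t" if "t \<in> carrier T" for t
      by (rule inj_onD[OF inj]) (use that h l(2) mon_homD(1)[OF l(1)] mon_homD(1)[of h T K] in auto)
    then show "h = restrict ?g (carrier T)"
      using h by (auto simp: extensional_def restrict_def)
  qed
qed

lemma jointly_monic_iff_inj_on:
  assumes R: "monoid R" and p1: "p1 \<in> mon_hom R X" and p2: "p2 \<in> mon_hom R Y"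
  shows "jointly_monic R p1 p2 \<longleftrightarrow> inj_on (\<lambda>r. (p1 r, p2 r)) (carrier R)"
proof
  interpret R: monoid R by fact
  assume J: "jointly_monic R p1 p2"
  let ?T = "(R \<times>\<times> R)\<lparr>carrier := {(r, r'). r \<in> carrier R \<and> r' \<in> carrier R \<and>
     p1 r = p1 r' \<and> p2 r = p2 r'}\<rparr>"
  have T: "monoid ?T"
    by (rule monoidI) (auto simp: DirProd_def R.m_assoc mon_homD[OF p1] mon_homD[OF p2])
  have fst: "fst \<in> mon_hom ?T R" and snd: "snd \<in> mon_hom ?T R"
    by (auto simp: mon_hom_def hom_def DirProd_def)
  have "\<forall>t\<in>carrier ?T. fst t = snd t"
    using J[unfolded jointly_monic_def, rule_format, of ?T fst snd] T fst snd by auto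
  then show "inj_on (\<lambda>r. (p1 r, p2 r)) (carrier R)" by (auto simp: inj_on_def)
next
  assume "inj_on (\<lambda>r. (p1 r, p2 r)) (carrier R)"
  then show "jointly_monic R p1 p2"
    unfolding jointly_monic_def inj_on_def by (metis mon_homD(1))
qed

lemma schreier_point_change_kernel:
  assumes S: "schreier_point N n B f M s" and K: "is_kernel K k B f M"
  shows "schreier_point K k B f M s"
proof -
  from S have N: "is_kernel N n B f M" by (simp add: schreier_point_def)
  define i where "i a = inv_into (carrier K) k (n a)" for a
  define j where "j a = inv_into (carrier N) n (k a)" for a
  have im: "n ` carrier N = k ` carrier K" and inj: "inj_on n (carrier N)" "inj_on k (carrier K)"
    using N K by (auto simp: is_kernel_def)
  have i: "i a \<in> carrier K \<and> k (i a) = n a" if "a \<in> carrier N" for a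
    using that im unfolding i_def by (metis f_inv_into_f image_eqI inv_into_into)
  have j: "j a \<in> carrier N \<and> n (j a) = k a" if "a \<in> carrier K" for a
    using that im unfolding j_def by (metis f_inv_into_f image_eqI inv_into_into)
  obtain q where q: "q \<in> carrier B \<rightarrow>\<^sub>E carrier N"
      "\<forall>b\<in>carrier B. b = n (q b) \<otimes>\<^bsub>B\<^esub> s (f b)"
    and uniq: "\<And>q'. q' \<in> carrier B \<rightarrow>\<^sub>E carrier N \<Longrightarrow>
      \<forall>b\<in>carrier B. b = n (q' b) \<otimes>\<^bsub>B\<^esub> s (f b) \<Longrightarrow> q' = q"
    using S unfolding schreier_point_def by blast
  have qN: "q b \<in> carrier N" if "b \<in> carrier B" for b using q that by auto
  have "\<exists>!q. q \<in> carrier B \<rightarrow>\<^sub>E carrier K \<and> (\<forall>b\<in>carrier B. b = k (q b) \<otimes>\<^bsub>B\<^esub> s (f b))"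
  proof (rule ex1I[of _ "restrict (i \<circ> q) (carrier B)"])
    show "restrict (i \<circ> q) (carrier B) \<in> carrier B \<rightarrow>\<^sub>E carrier K \<and>
      (\<forall>b\<in>carrier B. b = k (restrict (i \<circ> q) (carrier B) b) \<otimes>\<^bsub>B\<^esub> s (f b))"
      using q(2) i qN by simp
    fix p assume p: "p \<in> carrier B \<rightarrow>\<^sub>E carrier K \<and> (\<forall>b\<in>carrier B. b = k (p b) \<otimes>\<^bsub>B\<^esub> s (f b))"
    then have pK: "p b \<in> carrier K" if "b \<in> carrier B" for b using that by auto
    have "restrict (j \<circ> p) (carrier B) = q"
      by (rule uniq) (use p j pK in simp_all)
    then have "q b = j (p b)" if "b \<in> carrier B" for b using that by auto
    then have "k (i (q b)) = k (p b)" if "b \<in> carrier B" for b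
      using that i j pK by simp
    then have "i (q b) = p b" if "b \<in> carrier B" for b
      using that i pK qN inj(2) by (meson inj_onD)
    then show "p = restrict (i \<circ> q) (carrier B)"
      using p by (auto simp: fun_eq_iff PiE_def extensional_def restrict_def)
  qed
  with S K show ?thesis by (simp add: schreier_point_def)
qed

lemma S_reflexive_relation_kernel:
  assumes K: "is_kernel K k R p1 X"
  shows "S_reflexive_relation X R p1 p2 d \<longleftrightarrow>
    reflexive_relation X R p1 p2 d \<and> schreier_point K k R p1 X d"
proof
  assume "S_reflexive_relation X R p1 p2 d"
  then show "reflexive_relation X R p1 p2 d \<and> schreier_point K k R p1 X d"
    using schreier_point_change_kernel K unfolding S_reflexive_relation_def by blast
next
  assume a: "reflexive_relation X R p1 p2 d \<and> schreier_point K k R p1 X d"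
  then have R: "monoid R" and X: "monoid X" and p1: "p1 \<in> mon_hom R X"
    by (auto simp: reflexive_relation_def)
  interpret R: monoid R by fact
  interpret X: monoid X by fact
  let ?N = "\<lparr>carrier = kernel R X p1, mult = mult R, one = \<one>\<^bsub>R\<^esub>\<rparr>"
  have "monoid ?N"
    by (rule monoidI) (auto simp: kernel_def R.m_assoc mon_homD[OF p1])
  then have N: "is_kernel ?N id R p1 X"
    by (auto simp: is_kernel_def mon_hom_def hom_def kernel_def)
  then show "S_reflexive_relation X R p1 p2 d"
    using a schreier_point_change_kernel[OF _ N] unfolding S_reflexive_relation_def by blast
qed

end

theory Submission
  imports Defs
begin

text \<open>Over each $m \in M$ the Schreier representative $u$ gives $x = k(c) + u$. Since
  $u + k(a)$ lies in the same fibre, $u + k(a) = k(b) + u$, and commutativity of $K$ yields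
  $x + k(a) = k(c) + k(b) + u = k(b) + x$; this makes $R_{\mathbb{E}}$ a submonoid.
  If $k(a) + x = k(b) + x$ then $k(a + c) + u = k(b + c) + u$, so $a + c = b + c$ and $a = b$
  by cancellation; this is the uniqueness required of the Schreier retraction.\<close>

text \<open>Uniqueness of coefficients is given only relative to the representative
  \<open>u\<close>, not relative to \<open>x\<close>. Recording \<open>x = k c \<otimes> u\<close>
  allows a question about multiples of \<open>x\<close> to be carried over to \<open>u\<close> and
  settled there.\<close>

lemma schreier_extension_decomp:
  assumes "schreier_extension K k X f M" and "x \<in> carrier X"
  obtains u c where "u \<in> carrier X" "c \<in> carrier K" "x = k c \<otimes>\<^bsub>X\<^esub> u" "f u = f x"
    "\<And>y. y \<in> carrier X \<Longrightarrow> f y = f x \<Longrightarrow> \<exists>!a. a \<in> carrier K \<and> y = k a \<otimes>\<^bsub>X\<^esub> u"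
proof -
  have "f x \<in> carrier M"
    using assms by (auto simp: schreier_extension_def monoid_extension_def)
  then obtain u where u: "u \<in> carrier X" "f u = f x"
    "\<forall>y\<in>carrier X. f y = f x \<longrightarrow> (\<exists>!a. a \<in> carrier K \<and> y = k a \<otimes>\<^bsub>X\<^esub> u)"
    using assms(1) unfolding schreier_extension_def by blast
  then obtain c where "c \<in> carrier K" "x = k c \<otimes>\<^bsub>X\<^esub> u"
    using assms(2) by blast
  with u show thesis using that by simp
qed

text \<open>This substitutes for normality of the kernel: a kernel element can be moved from the
  right of \<open>x\<close> to its left, at the price of changing it.\<close>

lemma schreier_extension_kernel_commute:
  assumes ext: "schreier_extension K k X f M" and K: "comm_monoid K"
    and x: "x \<in> carrier X" and a: "a \<in> carrier K"
  shows "\<exists>b\<in>carrier K. x \<otimes>\<^bsub>X\<^esub> k a = k b \<otimes>\<^bsub>X\<^esub> x"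
proof -
  interpret K: comm_monoid K by fact
  have "monoid X" and "monoid M" and f: "f \<in> mon_hom X M" and k: "k \<in> mon_hom K X"
    and im: "k ` carrier K = kernel X M f"
    using ext by (auto simp: schreier_extension_def monoid_extension_def is_kernel_def)
  interpret X: monoid X by fact
  interpret M: monoid M by fact
  note kX = mon_homD(1)[OF k]
  obtain u c where u: "u \<in> carrier X" "c \<in> carrier K" "x = k c \<otimes>\<^bsub>X\<^esub> u" "f u = f x"
    and fibre: "\<And>y. y \<in> carrier X \<Longrightarrow> f y = f x \<Longrightarrow> \<exists>!a. a \<in> carrier K \<and> y = k a \<otimes>\<^bsub>X\<^esub> u"
    by (rule schreier_extension_decomp[OF ext x]) (rule that)
  have "f (k a) = \<one>\<^bsub>M\<^esub>" using im a by (auto simp: kernel_def)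
  \<comment> \<open>Multiplying by the kernel element \<open>k a\<close> keeps \<open>u\<close> in
    its fibre, so the product again has a coefficient relative to \<open>u\<close>.\<close>
  then have "f (u \<otimes>\<^bsub>X\<^esub> k a) = f x"
    using u(1,4) a kX by (simp add: mon_homD[OF f] mon_homD(1)[OF f x])
  then obtain b where b: "b \<in> carrier K" "u \<otimes>\<^bsub>X\<^esub> k a = k b \<otimes>\<^bsub>X\<^esub> u"
    using fibre[of "u \<otimes>\<^bsub>X\<^esub> k a"] u(1) a kX by blast
  have "x \<otimes>\<^bsub>X\<^esub> k a = k c \<otimes>\<^bsub>X\<^esub> (u \<otimes>\<^bsub>X\<^esub> k a)"
    using u(1-3) a kX by (simp add: X.m_assoc)
  also have "\<dots> = k (c \<otimes>\<^bsub>K\<^esub> b) \<otimes>\<^bsub>X\<^esub> u"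
    using u(1-3) b kX by (simp add: X.m_assoc mon_homD(2)[OF k])
  \<comment> \<open>Commutativity of \<open>K\<close> brings \<open>c\<close> next to
    \<open>u\<close>, where the two recombine to \<open>x\<close>.\<close>
  also have "\<dots> = k (b \<otimes>\<^bsub>K\<^esub> c) \<otimes>\<^bsub>X\<^esub> u"
    using u(2) b(1) by (simp add: K.m_comm)
  also have "\<dots> = k b \<otimes>\<^bsub>X\<^esub> x"
    using u(1-3) b kX by (simp add: X.m_assoc mon_homD(2)[OF k])
  finally show ?thesis using b(1) by blast
qed

text \<open>Relative to \<open>u\<close>, the common product has both \<open>a \<otimes> c\<close>
  and \<open>b \<otimes> c\<close> as coefficient. These agree by uniqueness, so the cancellation
  takes place in \<open>K\<close>; \<open>X\<close> itself is not assumed cancellative.\<close>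

lemma schreier_extension_kernel_cancel:
  assumes ext: "schreier_extension K k X f M" and K: "monoid_cancel K"
    and x: "x \<in> carrier X" and ab: "a \<in> carrier K" "b \<in> carrier K"
    and eq: "k a \<otimes>\<^bsub>X\<^esub> x = k b \<otimes>\<^bsub>X\<^esub> x"
  shows "a = b"
proof -
  interpret K: monoid_cancel K by fact
  have "monoid X" and "monoid M" and f: "f \<in> mon_hom X M" and k: "k \<in> mon_hom K X"
    and im: "k ` carrier K = kernel X M f"
    using ext by (auto simp: schreier_extension_def monoid_extension_def is_kernel_def)
  interpret X: monoid X by fact
  interpret M: monoid M by fact
  note kX = mon_homD(1)[OF k]
  obtain u c where u: "u \<in> carrier X" "c \<in> carrier K" "x = k c \<otimes>\<^bsub>X\<^esub> u" "f u = f x"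
    and fibre: "\<And>y. y \<in> carrier X \<Longrightarrow> f y = f x \<Longrightarrow> \<exists>!a. a \<in> carrier K \<and> y = k a \<otimes>\<^bsub>X\<^esub> u"
    by (rule schreier_extension_decomp[OF ext x]) (rule that)
  have shift: "k d \<otimes>\<^bsub>X\<^esub> x = k (d \<otimes>\<^bsub>K\<^esub> c) \<otimes>\<^bsub>X\<^esub> u" if "d \<in> carrier K" for d
    using that u(1-3) kX by (simp add: X.m_assoc mon_homD(2)[OF k])
  have "f (k a) = \<one>\<^bsub>M\<^esub>" using im ab(1) by (auto simp: kernel_def)
  then have "f (k a \<otimes>\<^bsub>X\<^esub> x) = f x"
    using x ab(1) kX by (simp add: mon_homD[OF f])
  then have "\<exists>!d. d \<in> carrier K \<and> k a \<otimes>\<^bsub>X\<^esub> x = k d \<otimes>\<^bsub>X\<^esub> u"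
    using fibre x ab(1) kX by blast
  moreover have "k a \<otimes>\<^bsub>X\<^esub> x = k (a \<otimes>\<^bsub>K\<^esub> c) \<otimes>\<^bsub>X\<^esub> u" "k a \<otimes>\<^bsub>X\<^esub> x = k (b \<otimes>\<^bsub>K\<^esub> c) \<otimes>\<^bsub>X\<^esub> u"
    using shift ab eq by simp_all
  ultimately have "a \<otimes>\<^bsub>K\<^esub> c = b \<otimes>\<^bsub>K\<^esub> c" using ab u(2) K.m_closed by blast
  then show ?thesis using ab u(2) by (rule K.r_cancel)
qed

lemma R\<^sub>E_simps:
  "carrier (R\<^sub>E K k X) = {(x, z). x \<in> carrier X \<and> z \<in> carrier X \<and>
     (\<exists>a\<in>carrier K. z = k a \<otimes>\<^bsub>X\<^esub> x)}"
  "(x, z) \<otimes>\<^bsub>R\<^sub>E K k X\<^esub> (x', z') = (x \<otimes>\<^bsub>X\<^esub> x', z \<otimes>\<^bsub>X\<^esub> z')"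
  "\<one>\<^bsub>R\<^sub>E K k X\<^esub> = (\<one>\<^bsub>X\<^esub>, \<one>\<^bsub>X\<^esub>)"
  by (auto simp: R\<^sub>E_def DirProd_def)

text \<open>Associativity and the unit laws are inherited componentwise from \<open>X\<close>. The
  issue is closure under products, which rests on moving \<open>x\<close> past
  \<open>k a'\<close>.\<close>

lemma monoid_R\<^sub>E:
  assumes ext: "schreier_extension K k X f M" and K: "comm_monoid K"
  shows "monoid (R\<^sub>E K k X)"
proof -
  interpret K: comm_monoid K by fact
  have "monoid X" and k: "k \<in> mon_hom K X"
    using ext by (auto simp: schreier_extension_def monoid_extension_def is_kernel_def)
  interpret X: monoid X by fact
  note kX = mon_homD(1)[OF k]
  have closed: "\<exists>b\<in>carrier K. (k a \<otimes>\<^bsub>X\<^esub> x) \<otimes>\<^bsub>X\<^esub> (k a' \<otimes>\<^bsub>X\<^esub> x') = k b \<otimes>\<^bsub>X\<^esub> (x \<otimes>\<^bsub>X\<^esub> x')"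
    if h: "x \<in> carrier X" "x' \<in> carrier X" "a \<in> carrier K" "a' \<in> carrier K" for x x' a a'
  proof -
    obtain b where b: "b \<in> carrier K" "x \<otimes>\<^bsub>X\<^esub> k a' = k b \<otimes>\<^bsub>X\<^esub> x"
      using schreier_extension_kernel_commute[OF ext K h(1,4)] by blast
    have "(k a \<otimes>\<^bsub>X\<^esub> x) \<otimes>\<^bsub>X\<^esub> (k a' \<otimes>\<^bsub>X\<^esub> x') = k a \<otimes>\<^bsub>X\<^esub> ((x \<otimes>\<^bsub>X\<^esub> k a') \<otimes>\<^bsub>X\<^esub> x')"
      using h kX by (simp add: X.m_assoc)
    also have "\<dots> = k (a \<otimes>\<^bsub>K\<^esub> b) \<otimes>\<^bsub>X\<^esub> (x \<otimes>\<^bsub>X\<^esub> x')"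
      using h b kX by (simp add: X.m_assoc mon_homD(2)[OF k])
    finally show ?thesis using h(3) b(1) by blast
  qed
  have "\<exists>a\<in>carrier K. \<one>\<^bsub>X\<^esub> = k a \<otimes>\<^bsub>X\<^esub> \<one>\<^bsub>X\<^esub>"
    by (rule bexI[of _ "\<one>\<^bsub>K\<^esub>"]) (simp_all add: mon_homD(3)[OF k])
  then have one: "\<one>\<^bsub>R\<^sub>E K k X\<^esub> \<in> carrier (R\<^sub>E K k X)"
    by (simp add: R\<^sub>E_simps)
  have mult: "r \<otimes>\<^bsub>R\<^sub>E K k X\<^esub> r' \<in> carrier (R\<^sub>E K k X)"
    if "r \<in> carrier (R\<^sub>E K k X)" "r' \<in> carrier (R\<^sub>E K k X)" for r r'
    using that kX by (cases r; cases r') (auto simp: R\<^sub>E_simps intro!: closed)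
  show ?thesis
    by (rule monoidI; (fact one mult)?) (auto simp: R\<^sub>E_simps X.m_assoc kX)
qed

text \<open>A pair \<open>(x, x)\<close> lies in the relation through the coefficient
  \<open>\<one>\<close> of \<open>K\<close>, which \<open>k\<close> sends to the unit of
  \<open>X\<close>.\<close>

lemma diagonal_mon_hom_R\<^sub>E:
  assumes "monoid X" and "monoid K" and k: "k \<in> mon_hom K X"
  shows "(\<lambda>x. (x, x)) \<in> mon_hom X (R\<^sub>E K k X)"
proof -
  interpret X: monoid X by fact
  interpret K: monoid K by fact
  have "\<exists>a\<in>carrier K. x = k a \<otimes>\<^bsub>X\<^esub> x" if "x \<in> carrier X" for x
    by (rule bexI[of _ "\<one>\<^bsub>K\<^esub>"]) (use that in \<open>simp_all add: mon_homD(3)[OF k]\<close>)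
  then show ?thesis by (auto simp: mon_hom_def hom_def R\<^sub>E_simps)
qed

text \<open>If the first component of a related pair is the unit, its second component is
  \<open>k a \<otimes> \<one> = k a\<close> for some \<open>a\<close>.\<close>

lemma is_kernel_R\<^sub>E:
  assumes "monoid X" and "monoid K" and k: "k \<in> mon_hom K X" and inj: "inj_on k (carrier K)"
  shows "is_kernel K (\<lambda>a. (\<one>\<^bsub>X\<^esub>, k a)) (R\<^sub>E K k X) fst X"
proof -
  interpret X: monoid X by fact
  interpret K: monoid K by fact
  note kX = mon_homD(1)[OF k]
  have "(\<lambda>a. (\<one>\<^bsub>X\<^esub>, k a)) \<in> mon_hom K (R\<^sub>E K k X)"
    using kX by (auto simp: mon_hom_def hom_def R\<^sub>E_simps mon_homD[OF k])
  moreover have "(\<lambda>a. (\<one>\<^bsub>X\<^esub>, k a)) ` carrier K = kernel (R\<^sub>E K k X) X fst"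
    using kX by (auto simp: kernel_def R\<^sub>E_simps)
  ultimately show ?thesis
    using inj K.monoid_axioms by (auto simp: is_kernel_def inj_on_def)
qed

text \<open>Values on \<open>A\<close> are forced pointwise, and extensionality forces the value
  \<open>undefined\<close> elsewhere, so the function itself is unique.\<close>

lemma ex1_PiE:
  assumes ex1: "\<And>x. x \<in> A \<Longrightarrow> \<exists>!y. y \<in> B \<and> P x y"
  shows "\<exists>!q. q \<in> A \<rightarrow>\<^sub>E B \<and> (\<forall>x\<in>A. P x (q x))"
proof (rule ex1I[of _ "\<lambda>x\<in>A. THE y. y \<in> B \<and> P x y"])
  show "(\<lambda>x\<in>A. THE y. y \<in> B \<and> P x y) \<in> A \<rightarrow>\<^sub>E B \<and>
    (\<forall>x\<in>A. P x ((\<lambda>x\<in>A. THE y. y \<in> B \<and> P x y) x))"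
    using theI'[OF ex1] by simp
  fix p assume p: "p \<in> A \<rightarrow>\<^sub>E B \<and> (\<forall>x\<in>A. P x (p x))"
  show "p = (\<lambda>x\<in>A. THE y. y \<in> B \<and> P x y)"
  proof
    fix x
    show "p x = (\<lambda>x\<in>A. THE y. y \<in> B \<and> P x y) x"
    proof (cases "x \<in> A")
      case True
      then have "p x \<in> B \<and> P x (p x)" using p by auto
      then have "(THE y. y \<in> B \<and> P x y) = p x" by (rule the1_equality[OF ex1[OF True]])
      then show ?thesis using True by simp
    next
      case False
      then show ?thesis using p by (auto simp: PiE_def extensional_def)
    qed
  qed
qed

theorem proposition5p5:
  fixes K :: "('k, 'p) monoid_scheme" and X :: "('x, 'q) monoid_scheme"
    and M :: "('m, 'r) monoid_scheme"
    and k :: "'k \<Rightarrow> 'x" and f :: "'x \<Rightarrow> 'm"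
  assumes "schreier_extension K k X f M"
    and "comm_monoid_cancel K"
  shows "schreier_point K (\<lambda>a. (\<one>\<^bsub>X\<^esub>, k a)) (R\<^sub>E K k X) fst X (\<lambda>x. (x, x)) \<and>
         S_reflexive_relation X (R\<^sub>E K k X) fst snd (\<lambda>x. (x, x))"
proof -
  note ext = assms(1)
  interpret K: comm_monoid_cancel K by fact
  have X: "monoid X" and k: "k \<in> mon_hom K X" and inj: "inj_on k (carrier K)"
    using ext by (auto simp: schreier_extension_def monoid_extension_def is_kernel_def)
  interpret X: monoid X by fact
  let ?R = "R\<^sub>E K k X" and ?k = "\<lambda>a. (\<one>\<^bsub>X\<^esub>, k a)" and ?d = "\<lambda>x. (x, x)"
  note kX = mon_homD(1)[OF k]
  have R: "monoid ?R" by (rule monoid_R\<^sub>E[OF ext K.comm_monoid_axioms])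
  have ker: "is_kernel K ?k ?R fst X"
    by (rule is_kernel_R\<^sub>E[OF X K.monoid_axioms k inj])
  have d: "?d \<in> mon_hom X ?R"
    by (rule diagonal_mon_hom_R\<^sub>E[OF X K.monoid_axioms k])
  have fst: "fst \<in> mon_hom ?R X" and snd: "snd \<in> mon_hom ?R X"
    by (auto simp: mon_hom_def hom_def R\<^sub>E_simps)
  \<comment> \<open>The factor \<open>?k a\<close> has first component \<open>\<one>\<close>, so the
    Schreier equation holds automatically there and becomes a condition on second
    components.\<close>
  have dec: "r = ?k a \<otimes>\<^bsub>?R\<^esub> ?d (fst r) \<longleftrightarrow> snd r = k a \<otimes>\<^bsub>X\<^esub> fst r"
    if "r \<in> carrier ?R" for r a
    using that by (auto simp: R\<^sub>E_simps)
  have "\<exists>!a. a \<in> carrier K \<and> r = ?k a \<otimes>\<^bsub>?R\<^esub> ?d (fst r)" if r: "r \<in> carrier ?R" for r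
  proof -
    obtain a where "a \<in> carrier K" "snd r = k a \<otimes>\<^bsub>X\<^esub> fst r" "fst r \<in> carrier X"
      using r by (auto simp: R\<^sub>E_simps)
    \<comment> \<open>Existence is membership in the relation; uniqueness is cancellation of
      \<open>fst r\<close>.\<close>
    then show ?thesis
      unfolding dec[OF r]
      by (auto intro: schreier_extension_kernel_cancel[OF ext K.monoid_cancel_axioms])
  qed
  then have "\<exists>!q. q \<in> carrier ?R \<rightarrow>\<^sub>E carrier K \<and> (\<forall>r\<in>carrier ?R. r = ?k (q r) \<otimes>\<^bsub>?R\<^esub> ?d (fst r))"
    by (rule ex1_PiE)
  then have point: "schreier_point K ?k ?R fst X ?d"
    using R X fst d ker by (simp add: schreier_point_def)
  have "jointly_monic ?R fst snd"
    by (simp add: jointly_monic_iff_inj_on[OF R fst snd])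
  then have "reflexive_relation X ?R fst snd ?d"
    using R X fst snd d by (simp add: reflexive_relation_def)
  \<comment> \<open>The definition asks for a kernel with carrier in the type of pairs, whereas
    \<open>K\<close> may live in any type; independence of the chosen kernel bridges this.\<close>
  with point show ?thesis
    by (simp add: S_reflexive_relation_kernel[OF ker])
qed

end
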